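(* Let $d\ge 2$, $N\ge 2d$, $1\le i\le d-1$, $0<h<1$, $M>0$. Let $F=\sum_{j=1}^d a_j\delta(x-x_j)\in\mathcal P_d$ form an $(i,h,M)$-cluster, and assume that $x_i-x_{i-1}\ge 3h$ (if $i\ge 2$) and $x_{i+2}-x_{i+1}\ge 3h$ (if $i\le d-2$). Put $\kappa=\frac{x_i+x_{i+1}}{2}$ and $C(F)=18M(1+|\kappa|)^N$. Then for each $\epsilon\ge C(F)h^3$ the $\epsilon$-error set $E_\epsilon(F)$ contains the local Prony curve $S_{F,i}(h)$, i.e. $S_{F,i}(h)\subset E_\epsilon(F)$.
   Context: Signals: $\mathcal P_d=\{(a,x)=(a_1,\dots,a_d,x_1,\dots,x_d)\in\mathbb R^{2d}: x_1<x_2<\dots<x_d\}$. A point $(a,x)\in\mathcal P_d$ is identified with the spike-train signal $F(x)=\sum_{j=1}^d a_j\delta(x-x_j)$; the $a_j$ are its amplitudes (any real numbers) and the $x_j$ its nodes. Moments: $m_k(F)=\sum_{j=1}^d a_jx_j^k$, $k=0,1,2,\dots$. Error set: for a fixed number $N\ge 2d$ of moments and $\epsilon>0$, $E_\epsilon(F)=\{F'\in\mathcal P_d: |m_k(F')-m_k(F)|\le\epsilon,\ k=0,\dots,N-1\}$. Cluster: $F\in\mathcal P_d$ forms an $(i,h,M)$-cluster ($0<h<1$, $M>0$, $1\le i\le d-1$) if $x_{i+1}-x_i=h$ and $|a_i|,|a_{i+1}|\le M$. Prony curve: $S_{F,i}\subset\mathcal P_d$ is the set of all $F'=\sum_{j=1}^d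 a'_j\delta(x-x'_j)\in\mathcal P_d$ with $a'_j=a_j$, $x'_j=x_j$ for all $j\ne i,i+1$, and $m_k(F')=m_k(F)$ for $k=0,1,2$. Local Prony curve: $S_{F,i}(h)$ is the set of those $F'\in S_{F,i}$ for which $(x'_i,x'_{i+1})$ belongs to the closed disk $D\subset\mathbb R^2$ of radius $\frac12h$ centered at $(x_i,x_{i+1})$. *)

theory Defs
  imports "HOL-Analysis.Analysis"
begin

text \<open>
  Vectors of \<open>\<real>\<^sup>d\<close> are functions on the index set \<open>{1..d}\<close>, extended by
  \<open>undefined\<close> elsewhere (\<open>PiE\<close>), so that equality of signals is equality of the \<open>2d\<close> coordinates.
  A signal is a pair of its amplitude vector and its node vector.
\<close>

type_synonym signal = "(nat \<Rightarrow> real) \<times> (nat \<Rightarrow> real)"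

abbreviation amp :: "signal \<Rightarrow> nat \<Rightarrow> real" where "amp F \<equiv> fst F"
abbreviation node :: "signal \<Rightarrow> nat \<Rightarrow> real" where "node F \<equiv> snd F"

definition signals :: "nat \<Rightarrow> signal set" where
  "signals d = {F. amp F \<in> {1..d} \<rightarrow>\<^sub>E UNIV \<and> node F \<in> {1..d} \<rightarrow>\<^sub>E UNIV
                   \<and> strict_mono_on {1..d} (node F)}"

definition moment :: "nat \<Rightarrow> nat \<Rightarrow> signal \<Rightarrow> real" where
  "moment d k F = (\<Sum>j = 1..d. amp F j * node F j ^ k)"

definition error_set :: "nat \<Rightarrow> nat \<Rightarrow> real \<Rightarrow> signal \<Rightarrow> signal set" where
  "error_set d N \<epsilon> F = {F' \<in> signals d. \<forall>k < N. \<bar>moment d k F' - moment d k F\<bar> \<le> \<epsilon>}"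

definition forms_cluster :: "nat \<Rightarrow> nat \<Rightarrow> real \<Rightarrow> real \<Rightarrow> signal \<Rightarrow> bool" where
  "forms_cluster d i h M F \<longleftrightarrow>
     F \<in> signals d \<and> 0 < h \<and> h < 1 \<and> 0 < M \<and> 1 \<le> i \<and> i \<le> d - 1 \<and>
     node F (i + 1) - node F i = h \<and> \<bar>amp F i\<bar> \<le> M \<and> \<bar>amp F (i + 1)\<bar> \<le> M"

definition prony_curve :: "nat \<Rightarrow> signal \<Rightarrow> nat \<Rightarrow> signal set" where
  "prony_curve d F i = {F' \<in> signals d.
     (\<forall>j \<in> {1..d} - {i, i + 1}. amp F' j = amp F j \<and> node F' j = node F j) \<and>
     (\<forall>k \<in> {0, 1, 2}. moment d k F' = moment d k F)}"

text \<open>The metric on \<open>real \<times> real\<close> is the Euclidean one, so \<open>cball\<close> is the closed round disk.\<close>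

definition local_prony_curve :: "nat \<Rightarrow> signal \<Rightarrow> nat \<Rightarrow> real \<Rightarrow> signal set" where
  "local_prony_curve d F i h = {F' \<in> prony_curve d F i.
     (node F' i, node F' (i + 1)) \<in> cball (node F i, node F (i + 1)) (h / 2)}"

end

theory Submission imports Defs begin

text \<open>
  Shift the origin to \<open>\<kappa>\<close>. The first two moment equations determine the new amplitudes from the
  new nodes, and since the nodes stay at distance at least \<open>h / 4\<close>, these amplitudes are at most
  \<open>8 * M\<close>. All nodes are within \<open>h\<close> of \<open>\<kappa>\<close>, so the shifted moments of order at least \<open>3\<close> change by
  \<open>O(M * h ^ 3)\<close>, while the moments of order \<open>0, 1, 2\<close> do not change. The binomial expansion around
  \<open>\<kappa>\<close> then contributes the factor \<open>(1 + \<bar>\<kappa>\<bar>) ^ N\<close>.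
\<close>

text \<open>The change of the moment of order \<open>k\<close> when only two summands differ:
  \<open>b\<close>, \<open>b'\<close> at nodes \<open>y\<close>, \<open>y'\<close> replace
  \<open>a\<close>, \<open>a'\<close> at \<open>x\<close>, \<open>x'\<close>. Taking bare reals
  instead of signals lets the origin be moved freely.\<close>

definition two_node_diff ::
  "real \<Rightarrow> real \<Rightarrow> real \<Rightarrow> real \<Rightarrow> real \<Rightarrow> real \<Rightarrow> real \<Rightarrow> real \<Rightarrow> nat \<Rightarrow> real" where
  "two_node_diff b b' y y' a a' x x' k = b * y ^ k + b' * y' ^ k - (a * x ^ k + a' * x' ^ k)"

lemma two_node_diff_shift:
  "two_node_diff b b' (y + c) (y' + c) a a' (x + c) (x' + c) k =
     (\<Sum>j\<le>k. of_nat (k choose j) * two_node_diff b b' y y' a a' x x' j * c ^ (k - j))"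
  unfolding two_node_diff_def binomial_ring
  by (simp add: sum_distrib_left sum.distrib sum_subtractf algebra_simps)

text \<open>After the binomial expansion each difference is at most \<open>B\<close>, and the
  remaining weights sum to \<open>(1 + \<bar>c\<bar>) ^ k\<close>.\<close>

lemma abs_two_node_diff_shift_le:
  assumes "\<And>j. j \<le> k \<Longrightarrow> \<bar>two_node_diff b b' y y' a a' x x' j\<bar> \<le> B"
  shows "\<bar>two_node_diff b b' (y + c) (y' + c) a a' (x + c) (x' + c) k\<bar> \<le> B * (1 + \<bar>c\<bar>) ^ k"
proof -
  let ?D = "two_node_diff b b' y y' a a' x x'"
  have "\<bar>\<Sum>j\<le>k. of_nat (k choose j) * ?D j * c ^ (k - j)\<bar>
      \<le> (\<Sum>j\<le>k. \<bar>of_nat (k choose j) * ?D j * c ^ (k - j)\<bar>)"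
    by (rule sum_abs)
  \<comment> \<open>The factor \<open>1 ^ j\<close> gives the summand the exact shape of
    \<open>binomial_ring\<close> for \<open>1 + \<bar>c\<bar>\<close>.\<close>
  also have "\<dots> \<le> (\<Sum>j\<le>k. B * (of_nat (k choose j) * 1 ^ j * \<bar>c\<bar> ^ (k - j)))"
  proof (rule sum_mono)
    fix j assume "j \<in> {..k}"
    then have "\<bar>?D j\<bar> * (of_nat (k choose j) * \<bar>c\<bar> ^ (k - j))
        \<le> B * (of_nat (k choose j) * \<bar>c\<bar> ^ (k - j))"
      using assms by (intro mult_right_mono) auto
    then show "\<bar>of_nat (k choose j) * ?D j * c ^ (k - j)\<bar>
        \<le> B * (of_nat (k choose j) * 1 ^ j * \<bar>c\<bar> ^ (k - j))"
      by (simp add: abs_mult power_abs mult_ac)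
  qed
  also have "\<dots> = B * (1 + \<bar>c\<bar>) ^ k"
    by (simp add: binomial_ring sum_distrib_left)
  finally show ?thesis
    by (simp add: two_node_diff_shift)
qed

lemma two_node_diff_shift_eq_0:
  assumes "\<And>j. j \<le> k \<Longrightarrow> two_node_diff b b' y y' a a' x x' j = 0"
  shows "two_node_diff b b' (y + c) (y' + c) a a' (x + c) (x' + c) k = 0"
  using assms by (simp add: two_node_diff_shift)

text \<open>Meant for Cramer's rule: \<open>g\<close> is the gap between the new nodes, and
  \<open>s\<close>, \<open>t\<close> are signed distances from the old nodes to the other new node.
  The constant is \<open>2 * h\<close> divided by \<open>h / 4\<close>.\<close>

lemma abs_two_amplitudes_le:
  fixes b g a a' s t M h :: real
  assumes "b * g = a * s + a' * t" "g \<ge> h / 4" "0 < h" "\<bar>a\<bar> \<le> M" "\<bar>a'\<bar> \<le> M"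
    and "\<bar>s\<bar> + \<bar>t\<bar> \<le> 2 * h"
  shows "\<bar>b\<bar> \<le> 8 * M"
proof -
  have "\<bar>b\<bar> * (h / 4) \<le> \<bar>b\<bar> * g"
    using assms by (intro mult_left_mono) auto
  also have "\<dots> = \<bar>a * s + a' * t\<bar>"
    using assms by (simp flip: assms(1) add: abs_mult)
  also have "\<dots> \<le> \<bar>a\<bar> * \<bar>s\<bar> + \<bar>a'\<bar> * \<bar>t\<bar>"
    using abs_triangle_ineq[of "a * s" "a' * t"] by (simp add: abs_mult)
  also have "\<dots> \<le> M * \<bar>s\<bar> + M * \<bar>t\<bar>"
    using assms by (intro add_mono mult_right_mono) auto
  also have "\<dots> = M * (\<bar>s\<bar> + \<bar>t\<bar>)"
    by (simp add: algebra_simps)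
  also have "\<dots> \<le> M * (2 * h)"
    using assms by (intro mult_left_mono) auto
  finally show ?thesis
    using \<open>0 < h\<close> by simp
qed

lemma abs_mult_power_le:
  fixes b y B h :: real
  assumes "\<bar>b\<bar> \<le> B" "\<bar>y\<bar> \<le> h" "h \<le> 1" "n \<le> j"
  shows "\<bar>b * y ^ j\<bar> \<le> B * h ^ n"
proof -
  have "0 \<le> h" using assms by linarith
  have "\<bar>y\<bar> ^ j \<le> h ^ j"
    using assms by (intro power_mono) auto
  also have "\<dots> \<le> h ^ n"
    using assms \<open>0 \<le> h\<close> by (intro power_decreasing) auto
  finally show ?thesis
    using assms unfolding abs_mult power_abs by (intro mult_mono) auto
qed

lemma centered_two_node_diff_bound:
  fixes b b' y y' a a' h M :: real
  defines "D \<equiv> two_node_diff b b' y y' a a' (- h / 2) (h / 2)"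
  assumes "0 < h" "h < 1" "\<bar>a\<bar> \<le> M" "\<bar>a'\<bar> \<le> M"
    and disk: "(y + h / 2)\<^sup>2 + (y' - h / 2)\<^sup>2 \<le> (h / 2)\<^sup>2"
    and zero: "\<And>k. k \<le> 2 \<Longrightarrow> D k = 0"
  shows "\<bar>D k\<bar> \<le> 18 * M * h ^ 3"
proof (cases "k \<le> 2")
  case True
  then show ?thesis
    using assms by simp
next
  case False
  \<comment> \<open>The displacements of the two nodes.\<close>
  define u v where "u = y + h / 2" and "v = y' - h / 2"
  have uv: "u\<^sup>2 + v\<^sup>2 \<le> (h / 2)\<^sup>2"
    using disk by (simp add: u_def v_def)
  have "u\<^sup>2 \<le> (h / 2)\<^sup>2" "v\<^sup>2 \<le> (h / 2)\<^sup>2"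
    using uv zero_le_power2[of u] zero_le_power2[of v] by linarith+
  then have u: "\<bar>u\<bar> \<le> h / 2" and v: "\<bar>v\<bar> \<le> h / 2"
    using \<open>0 < h\<close> by (simp_all flip: abs_le_square_iff)
  \<comment> \<open>The round disk keeps the nodes apart: bounding \<open>u\<close> and
    \<open>v\<close> by \<open>h / 2\<close> separately would allow \<open>y = y'\<close>. Here
    \<open>(u - v)\<^sup>2\<close> is at most \<open>h\<^sup>2 / 2\<close>, and \<open>3 / 4\<close>
    is a rational bound for \<open>1 / sqrt 2\<close>.\<close>
  have "(u - v)\<^sup>2 \<le> 2 * (u\<^sup>2 + v\<^sup>2)"
    using zero_le_power2[of "u + v"] by (simp add: power2_eq_square algebra_simps)
  also have "\<dots> \<le> (3 * h / 4)\<^sup>2"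
    using uv by (simp add: power_mult_distrib power_divide) (use zero_le_power2[of h] in linarith)
  finally have "\<bar>u - v\<bar> \<le> 3 * h / 4"
    using \<open>0 < h\<close> by (simp flip: abs_le_square_iff)
  then have gap: "y' - y \<ge> h / 4"
    unfolding u_def v_def by linarith
  have m0: "b + b' = a + a'"
    using zero[of 0] by (simp add: D_def two_node_diff_def)
  have m1: "b * y + b' * y' = a' * (h / 2) - a * (h / 2)"
    using zero[of 1] by (simp add: D_def two_node_diff_def)
  \<comment> \<open>This eliminates \<open>b'\<close> from \<open>m0\<close> and
    \<open>m1\<close>.\<close>
  have "b * (y' - y) = (b + b') * y' - (b * y + b' * y')"
    by (simp add: algebra_simps)
  also have "\<dots> = a * (y' + h / 2) + a' * (y' - h / 2)"
    unfolding m0 m1 by (simp add: algebra_simps)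
  finally have "b * (y' - y) = \<dots>" .
  \<comment> \<open>Since \<open>y'\<close> lies between \<open>0\<close> and \<open>h\<close>, the
    two terms are at most \<open>3 * h / 2\<close> and \<open>h / 2\<close>.\<close>
  moreover have "\<bar>y' + h / 2\<bar> + \<bar>y' - h / 2\<bar> \<le> 2 * h"
    using v \<open>0 < h\<close> unfolding v_def by linarith
  ultimately have b: "\<bar>b\<bar> \<le> 8 * M"
    using assms gap by (intro abs_two_amplitudes_le)
  have "b' * (y' - y) = (b * y + b' * y') - (b + b') * y"
    by (simp add: algebra_simps)
  also have "\<dots> = a * (- h / 2 - y) + a' * (h / 2 - y)"
    unfolding m0 m1 by (simp add: algebra_simps)
  finally have "b' * (y' - y) = \<dots>" .
  moreover have "\<bar>- h / 2 - y\<bar> + \<bar>h / 2 - y\<bar> \<le> 2 * h"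
    using u \<open>0 < h\<close> unfolding u_def by linarith
  ultimately have b': "\<bar>b'\<bar> \<le> 8 * M"
    using assms gap by (intro abs_two_amplitudes_le)
  have "\<bar>y\<bar> \<le> h" "\<bar>y'\<bar> \<le> h"
    using u v unfolding u_def v_def by linarith+
  \<comment> \<open>As \<open>k\<close> is at least \<open>3\<close> and \<open>h < 1\<close>,
    powers of order \<open>k\<close> are bounded by \<open>h ^ 3\<close>. The four coefficients add
    up to 8 + 8 + 1 + 1 = 18.\<close>
  then have "\<bar>b * y ^ k\<bar> \<le> 8 * M * h ^ 3" "\<bar>b' * y' ^ k\<bar> \<le> 8 * M * h ^ 3"
    "\<bar>a * (- h / 2) ^ k\<bar> \<le> M * h ^ 3" "\<bar>a' * (h / 2) ^ k\<bar> \<le> M * h ^ 3"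
    using assms b b' False by (intro abs_mult_power_le; simp)+
  then show ?thesis
    unfolding D_def two_node_diff_def by linarith
qed

lemma moment_diff_two_nodes:
  assumes "1 \<le> i" "i + 1 \<le> d"
    and "\<And>j. j \<in> {1..d} - {i, i + 1} \<Longrightarrow> amp G j = amp F j \<and> node G j = node F j"
  shows "moment d k G - moment d k F =
    two_node_diff (amp G i) (amp G (i + 1)) (node G i) (node G (i + 1))
      (amp F i) (amp F (i + 1)) (node F i) (node F (i + 1)) k"
proof -
  have "moment d k H = (\<Sum>j\<in>{1..d} - {i, i + 1}. amp H j * node H j ^ k)
      + (amp H i * node H i ^ k + amp H (i + 1) * node H (i + 1) ^ k)" for H
    unfolding moment_def using assms(1,2) by (subst sum.subset_diff[of "{i, i + 1}"]) auto
  moreover have "(\<Sum>j\<in>{1..d} - {i, i + 1}. amp G j * node G j ^ k) =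
      (\<Sum>j\<in>{1..d} - {i, i + 1}. amp F j * node F j ^ k)"
    using assms(3) by (intro sum.cong) auto
  ultimately show ?thesis
    by (simp add: two_node_diff_def)
qed

theorem theorem4p1:
  fixes d N i :: nat and h M \<kappa> C \<epsilon> :: real and F :: signal
  assumes "d \<ge> 2" and "N \<ge> 2 * d" and "1 \<le> i" and "i \<le> d - 1"
    and "0 < h" and "h < 1" and "M > 0"
    and "F \<in> signals d"
    and "forms_cluster d i h M F"
    and "i \<ge> 2 \<Longrightarrow> node F i - node F (i - 1) \<ge> 3 * h"
    and "i \<le> d - 2 \<Longrightarrow> node F (i + 2) - node F (i + 1) \<ge> 3 * h"
    and "\<kappa> = (node F i + node F (i + 1)) / 2"
    and "C = 18 * M * (1 + \<bar>\<kappa>\<bar>) ^ N"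
    and "\<epsilon> \<ge> C * h ^ 3"
  shows "local_prony_curve d F i h \<subseteq> error_set d N \<epsilon> F"
proof
  fix G assume "G \<in> local_prony_curve d F i h"
  then have G: "G \<in> signals d"
    and same: "\<And>j. j \<in> {1..d} - {i, i + 1} \<Longrightarrow> amp G j = amp F j \<and> node G j = node F j"
    and mom: "\<And>k. k \<in> {0, 1, 2} \<Longrightarrow> moment d k G = moment d k F"
    and disk: "dist (node F i, node F (i + 1)) (node G i, node G (i + 1)) \<le> h / 2"
    unfolding local_prony_curve_def prony_curve_def by auto
  define x x' y y' where "x = node F i" and "x' = node F (i + 1)"
    and "y = node G i" and "y' = node G (i + 1)"
  define a a' b b' where "a = amp F i" and "a' = amp F (i + 1)"
    and "b = amp G i" and "b' = amp G (i + 1)"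
  have diff: "moment d k G - moment d k F = two_node_diff b b' y y' a a' x x' k" for k
    using moment_diff_two_nodes[of i d G F k] same assms(1,3,4)
    by (simp add: x_def x'_def y_def y'_def a_def a'_def b_def b'_def)
  have zero: "two_node_diff b b' y y' a a' x x' k = 0" if "k \<le> 2" for k
  proof -
    from that have "k \<in> {0, 1, 2}" by auto
    with mom show ?thesis by (simp flip: diff)
  qed
  have "x' - x = h" and a: "\<bar>a\<bar> \<le> M" "\<bar>a'\<bar> \<le> M"
    using assms(9) by (auto simp: forms_cluster_def x_def x'_def a_def a'_def)
  then have x: "x = - h / 2 + \<kappa>" "x' = h / 2 + \<kappa>"
    using assms(12) unfolding x_def x'_def by (simp_all add: field_simps)
  \<comment> \<open>The change of the moments about \<open>\<kappa>\<close>, where the old nodes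
    become \<open>- h / 2\<close> and \<open>h / 2\<close>.\<close>
  let ?D = "two_node_diff b b' (y - \<kappa>) (y' - \<kappa>) a a' (- h / 2) (h / 2)"
  have D0: "?D k = 0" if "k \<le> 2" for k
    using two_node_diff_shift_eq_0[of k b b' y y' a a' x x' "- \<kappa>"] zero that by (simp add: x)
  have "sqrt ((x - y)\<^sup>2 + (x' - y')\<^sup>2) \<le> h / 2"
    using disk by (simp add: dist_prod_def dist_real_def x_def x'_def y_def y'_def)
  then have "(x - y)\<^sup>2 + (x' - y')\<^sup>2 \<le> (h / 2)\<^sup>2"
    by (rule sqrt_le_D)
  moreover have "(x - y)\<^sup>2 + (x' - y')\<^sup>2 = (y - \<kappa> + h / 2)\<^sup>2 + (y' - \<kappa> - h / 2)\<^sup>2"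
    unfolding x by (simp add: power2_eq_square algebra_simps)
  ultimately have D: "\<bar>?D k\<bar> \<le> 18 * M * h ^ 3" for k
    using assms(5,6) a D0 by (intro centered_two_node_diff_bound) auto
  have "\<bar>moment d k G - moment d k F\<bar> \<le> \<epsilon>" if "k < N" for k
  proof -
    \<comment> \<open>Shifting back by \<open>\<kappa>\<close> applies the uniform bound
      \<open>D\<close> to all orders up to \<open>k\<close>.\<close>
    have "\<bar>moment d k G - moment d k F\<bar> \<le> 18 * M * h ^ 3 * (1 + \<bar>\<kappa>\<bar>) ^ k"
      using abs_two_node_diff_shift_le[where k = k and c = \<kappa>, OF D] by (simp add: diff x)
    also have "\<dots> \<le> 18 * M * h ^ 3 * (1 + \<bar>\<kappa>\<bar>) ^ N"
      using that assms(5,7) by (intro mult_left_mono power_increasing) auto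
    also have "\<dots> \<le> \<epsilon>"
      using assms(13,14) by (simp add: mult_ac)
    finally show ?thesis .
  qed
  with G show "G \<in> error_set d N \<epsilon> F"
    by (simp add: error_set_def)
qed

end
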